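(* Let $n\ge 1$ be an integer and let $S_n=K_{1,n}$ be the star graph with $n$ edges. Then there are exactly $2^{n-1}$ possible merge trees $M_f$ induced by critical discrete Morse functions $f\colon S_n\to\mathbb{R}$, where merge trees are counted as unlabeled binary trees, i.e. up to rooted tree isomorphism preserving left and right children.
   Context: Graphs are finite and simple; a \emph{simplex} of a graph is a vertex or an edge. A function $f$ from the set of simplices of a graph $G$ to $\mathbb{R}$ (written $f\colon G\to\mathbb{R}$) is a \emph{discrete Morse function} if (i) $f(v)\le f(e)$ whenever $v$ is an endpoint of the edge $e$; (ii) $f$ is at most 2--1 (each value is taken by at most two simplices); (iii) if $f(\sigma)=f(\tau)$ then $\sigma\subseteq\tau$ or $\tau\subseteq\sigma$. A simplex $\sigma$ is \emph{critical} if no other simplex has the value $f(\sigma)$. A discrete Morse function is called \emph{critical} if every simplex is critical, i.e. $f$ is injective. A \emph{binary tree} is a (finite) rooted tree in which each vertex has at most two children, each child being designated as the left (L) or the right (R) child, with at most one of each. It is \emph{full} if every vertex has $0$ or $2$ children. A \emph{merge tree} is a full binary tree. Its vertices are called nodes. Construction of the induced merge tree $M_f$ for a critical discrete Morse function $f$ on a tree $T$ with at least one edge. For a value $c$ of $f$ let $T_{c-\epsilon}$ be the subgraph of $T$ consisting of all simplices $\sigma$ with $f(\sigma)<c$, and for a vertex $w$ of it let $T_{c-\epsilon}[w]$ be the connected component containing $w$. Each node $x$ of $M_f$ carries a real label $f_M(x)$, which is a value of $f$, and a direction L or R (labels are used only for the construction and are then forgotten). (1) Start with a root node, labeled by the largest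 value of $f$ (which is attained on an edge), with direction L. (2) Whenever a node $x$ has label $c=f(uv)$ for an edge $uv$ of $T$, create two children $n_u,n_v$ of $x$ with labels $f_M(n_u)=\max\{f(\sigma):\sigma\in T_{c-\epsilon}[u]\}$ and $f_M(n_v)=\max\{f(\sigma):\sigma\in T_{c-\epsilon}[v]\}$. If $\min\{f(\sigma):\sigma\in T_{c-\epsilon}[u]\}<\min\{f(\sigma):\sigma\in T_{c-\epsilon}[v]\}$, give $n_u$ the same direction as $x$ and $n_v$ the opposite direction; if the reverse inequality holds, give $n_v$ the same direction as $x$ and $n_u$ the opposite direction. The child with direction L is the left child and the child with direction R is the right child. (3) A node whose label is the value of a vertex gets no children. Continue until all nodes labeled by edges have been given children. *)

theory Defs
  imports Complex_Main "HOL-Library.Tree"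
begin

section \<open>Graphs and their simplices\<close>

record 'a graph =
  verts :: "'a set"
  edges :: "'a set set"

definition simple_graph :: "'a graph \<Rightarrow> bool" where
  "simple_graph G \<longleftrightarrow>
     finite (verts G) \<and> (\<forall>e\<in>edges G. e \<subseteq> verts G \<and> card e = 2)"

text \<open>A vertex \<open>v\<close>, regarded as a simplex, is the singleton \<open>{v}\<close>; thus incidence of simplices
  is set inclusion.\<close>

definition simplices :: "'a graph \<Rightarrow> 'a set set" where
  "simplices G = (\<lambda>v. {v}) ` verts G \<union> edges G"

definition component :: "'a graph \<Rightarrow> 'a \<Rightarrow> 'a graph" where
  "component G w =
     (let C = {v \<in> verts G. (w, v) \<in> {(x, y). {x, y} \<in> edges G}\<^sup>*}
      in \<lparr>verts = C, edges = {e \<in> edges G. e \<subseteq> C}\<rparr>)"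

definition star_graph :: "nat \<Rightarrow> nat graph" where
  "star_graph n = \<lparr>verts = {0..n}, edges = {{0, i} | i. i \<in> {1..n}}\<rparr>"

lemma simple_graph_star_graph: "simple_graph (star_graph n)"
  by (auto simp: simple_graph_def star_graph_def card_insert_if)


section \<open>Discrete Morse functions\<close>

text \<open>Only the values of \<open>f\<close> on the simplices of \<open>G\<close> matter. The finiteness assertion is there
  because the cardinality of an infinite set is \<open>0\<close>.\<close>

definition discrete_morse :: "'a graph \<Rightarrow> ('a set \<Rightarrow> real) \<Rightarrow> bool" where
  "discrete_morse G f \<longleftrightarrow>
     (\<forall>e\<in>edges G. \<forall>v\<in>e. f {v} \<le> f e) \<and>
     (\<forall>r. finite {\<sigma> \<in> simplices G. f \<sigma> = r} \<and> card {\<sigma> \<in> simplices G. f \<sigma> = r} \<le> 2) \<and>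
     (\<forall>\<sigma>\<in>simplices G. \<forall>\<tau>\<in>simplices G. f \<sigma> = f \<tau> \<longrightarrow> \<sigma> \<subseteq> \<tau> \<or> \<tau> \<subseteq> \<sigma>)"

definition critical_simplex :: "'a graph \<Rightarrow> ('a set \<Rightarrow> real) \<Rightarrow> 'a set \<Rightarrow> bool" where
  "critical_simplex G f \<sigma> \<longleftrightarrow>
     \<sigma> \<in> simplices G \<and> (\<forall>\<tau>\<in>simplices G. \<tau> \<noteq> \<sigma> \<longrightarrow> f \<tau> \<noteq> f \<sigma>)"

definition critical_discrete_morse :: "'a graph \<Rightarrow> ('a set \<Rightarrow> real) \<Rightarrow> bool" where
  "critical_discrete_morse G f \<longleftrightarrow>
     discrete_morse G f \<and> (\<forall>\<sigma>\<in>simplices G. critical_simplex G f \<sigma>)"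

lemma critical_discrete_morse_iff_inj_on:
  "critical_discrete_morse G f \<longleftrightarrow> discrete_morse G f \<and> inj_on f (simplices G)"
  by (auto simp: critical_discrete_morse_def critical_simplex_def inj_on_def)


section \<open>The induced merge tree\<close>

text \<open>The subgraph \<open>G\<^bsub>c-\<epsilon>\<^esub>\<close>.\<close>

definition sublevel :: "'a graph \<Rightarrow> ('a set \<Rightarrow> real) \<Rightarrow> real \<Rightarrow> 'a graph" where
  "sublevel G f c = \<lparr>verts = {v \<in> verts G. f {v} < c}, edges = {e \<in> edges G. f e < c}\<rparr>"

definition comp_max :: "'a graph \<Rightarrow> ('a set \<Rightarrow> real) \<Rightarrow> real \<Rightarrow> 'a \<Rightarrow> real" where
  "comp_max G f c w = Max (f ` simplices (component (sublevel G f c) w))"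

definition comp_min :: "'a graph \<Rightarrow> ('a set \<Rightarrow> real) \<Rightarrow> real \<Rightarrow> 'a \<Rightarrow> real" where
  "comp_min G f c w = Min (f ` simplices (component (sublevel G f c) w))"

datatype direction = Left | Right

fun opposite :: "direction \<Rightarrow> direction" where
  "opposite Left = Right"
| "opposite Right = Left"

text \<open>The binary trees are those of the library, whose \<^const>\<open>Node\<close> is a vertex of the tree, while
  \<^const>\<open>Leaf\<close> is the empty tree and stands for an absent child: a vertex without children
  is \<open>Node Leaf x Leaf\<close>.\<close>

fun full_binary :: "'a tree \<Rightarrow> bool" where
  "full_binary Leaf \<longleftrightarrow> True"
| "full_binary (Node l x r) \<longleftrightarrow> (l = Leaf \<longleftrightarrow> r = Leaf) \<and> full_binary l \<and> full_binary r"

text \<open>\<open>joined d c t s\<close> is a node with label \<open>c\<close> and direction \<open>d\<close> whose child \<open>t\<close> has the same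
  direction \<open>d\<close> and whose child \<open>s\<close> has the opposite one.\<close>

fun joined :: "direction \<Rightarrow> 'b \<Rightarrow> 'b tree \<Rightarrow> 'b tree \<Rightarrow> 'b tree" where
  "joined Left c t s = Node t c s"
| "joined Right c t s = Node s c t"

text \<open>\<open>grows G f d c t\<close>: starting from a node with direction \<open>d\<close> and label \<open>c\<close>, the construction
  produces the labelled tree \<open>t\<close> below (and including) this node. In the rule for edges, \<open>u\<close> names
  the endpoint whose component has the smaller minimum; as \<open>{u, v} = {v, u}\<close>, this
  covers both orders of the two minima.\<close>

inductive grows :: "'a graph \<Rightarrow> ('a set \<Rightarrow> real) \<Rightarrow> direction \<Rightarrow> real \<Rightarrow> real tree \<Rightarrow> bool"
  for G f where
  vertex: "v \<in> verts G \<Longrightarrow> f {v} = c \<Longrightarrow> grows G f d c (Node Leaf c Leaf)"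
| edge: "{u, v} \<in> edges G \<Longrightarrow> f {u, v} = c \<Longrightarrow> comp_min G f c u < comp_min G f c v \<Longrightarrow>
    grows G f d (comp_max G f c u) t \<Longrightarrow> grows G f (opposite d) (comp_max G f c v) s \<Longrightarrow>
    grows G f d c (joined d c t s)"

definition labelled_merge_tree :: "'a graph \<Rightarrow> ('a set \<Rightarrow> real) \<Rightarrow> real tree" where
  "labelled_merge_tree G f = (THE t. grows G f Left (Max (f ` simplices G)) t)"

text \<open>Forgetting the labels leaves a \<^typ>\<open>unit tree\<close>. Two such trees are equal iff they are
  isomorphic as rooted trees with left and right children.\<close>

definition merge_tree :: "'a graph \<Rightarrow> ('a set \<Rightarrow> real) \<Rightarrow> unit tree" where
  "merge_tree G f = map_tree (\<lambda>_. ()) (labelled_merge_tree G f)"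

lemma grows_full_binary: "grows G f d c t \<Longrightarrow> t \<noteq> Leaf \<and> full_binary t"
proof (induction rule: grows.induct)
  case (edge u v c d t s)
  then show ?case by (cases d) auto
qed simp

end

theory Submission
  imports Defs
begin

text \<open>In a star, removing the edge of largest value splits off a single leaf \<open>m\<close> from the component of
  the centre, which is again a star. Hence a merge tree of the star with \<open>n\<close> edges is a caterpillar:
  one child of every inner node is a vertex without children, and the other continues the spine. The
  side of the spine is the direction of the node if \<open>f {m}\<close> exceeds the minimum on the remaining
  star, and the opposite one otherwise. As \<open>f {m}\<close> can be chosen freely below \<open>f {0, m}\<close>, all
  sequences of sides occur; only at the last inner node do both sides give the same tree.\<close>

section \<open>Caterpillars\<close>

text \<open>The index counts the inner nodes and so will match the number of edges of the star.
  \<open>e\<close> is the side on which the spine continues, recorded directly instead of relative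
  to the direction of the node.\<close>

fun caterpillars :: "nat \<Rightarrow> unit tree set" where
  "caterpillars 0 = {Node Leaf () Leaf}"
| "caterpillars (Suc k) = (\<Union>e. (\<lambda>t. joined e () t (Node Leaf () Leaf)) ` caterpillars k)"

lemma UNIV_direction: "(UNIV :: direction set) = {Left, Right}"
  using direction.exhaust by auto

lemma finite_caterpillars: "finite (caterpillars k)"
  by (induction k) (auto simp: UNIV_direction)

text \<open>Each further inner node doubles the count, because the two sides give disjoint copies of
  the previous set. This fails only for a spine that is a single vertex, so the doubling starts at
  one inner node, where there is a single tree.\<close>

lemma card_caterpillars: "card (caterpillars (Suc k)) = 2 ^ k"
proof (induction k)
  case 0
  then show ?case by (simp add: UNIV_direction)
next
  case (Suc k)
  let ?g = "\<lambda>e t. joined e () t (Node Leaf () Leaf)"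
  have inner: "t \<noteq> Node Leaf () Leaf" if t: "t \<in> caterpillars (Suc k)" for t
  proof -
    have "s \<noteq> Leaf" if "s \<in> caterpillars j" for j and s :: "unit tree"
      using that by (cases j) (auto simp: UNIV_direction)
    then show ?thesis
      using t by (auto simp: UNIV_direction)
  qed
  have "caterpillars (Suc (Suc k)) =
      ?g Left ` caterpillars (Suc k) \<union> ?g Right ` caterpillars (Suc k)"
    unfolding caterpillars.simps(2)[of "Suc k"] UNIV_direction by blast
  also have "card \<dots> = card (?g Left ` caterpillars (Suc k)) + card (?g Right ` caterpillars (Suc k))"
  proof (rule card_Un_disjoint)
    \<comment> \<open>A common element would have equal left and right children, so its spine would
      be the childless vertex, which \<open>inner\<close> rules out.\<close>
    show "?g Left ` caterpillars (Suc k) \<inter> ?g Right ` caterpillars (Suc k) = {}"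
      using inner by (force simp del: caterpillars.simps)
  qed (simp_all add: finite_caterpillars del: caterpillars.simps)
  also have "\<dots> = 2 * card (caterpillars (Suc k))"
    by (simp add: card_image inj_on_def del: caterpillars.simps)
  finally show ?case
    using Suc by simp
qed

lemma map_tree_joined: "map_tree g (joined d c t s) = joined d (g c) (map_tree g t) (map_tree g s)"
  by (cases d) auto

lemma joined_opposite: "joined (opposite d) c t s = joined d c s t"
  by (cases d) auto


section \<open>Uniqueness of the induced merge tree\<close>

text \<open>By injectivity a label determines its simplex, and hence the rule that was applied; the
  strict comparison of the two minima then determines which endpoint plays the role of
  \<open>u\<close>.\<close>

lemma grows_unique:
  assumes G: "simple_graph G" and inj: "inj_on f (simplices G)"
    and "grows G f d c t" and "grows G f d c t'"
  shows "t = t'"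
proof -
  have vert_edge: False if "v \<in> verts G" "{u, w} \<in> edges G" "f {v} = f {u, w}" for u v w
  proof -
    have "{v} = {u, w}"
      using that inj by (auto simp: inj_on_def simplices_def)
    moreover have "card {u, w} = 2"
      using G that by (auto simp: simple_graph_def)
    ultimately show False
      by (metis card_1_singleton_iff is_singletonI is_singleton_altdef numeral_eq_one_iff
          semiring_norm(85))
  qed
  show ?thesis
    using assms(3,4)
  proof (induction arbitrary: t' rule: grows.induct)
    case (vertex v c d)
    from vertex(3) show ?case
      by cases (use vertex vert_edge in auto)
  next
    case (edge u v c d t s)
    from edge.prems show ?case
    proof cases
      case (vertex w)
      then show ?thesis
        using edge.hyps(1,2) vert_edge by metis
    next
      case other: (edge u' v' t2 s2)
      have "{u', v'} = {u, v}"
        using other(2,3) edge.hyps(1,2) by (intro inj_onD[OF inj]) (auto simp: simplices_def)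
      then have "u' = u \<and> v' = v"
        using other(4) edge.hyps(3) by (auto simp: doubleton_eq_iff)
      then show ?thesis
        using other edge.IH by auto
    qed
  qed
qed

text \<open>Discharges the definite description: afterwards it is enough to exhibit one derivation
  with \<open>grows\<close>.\<close>

lemma labelled_merge_tree_eq:
  assumes "simple_graph G" and "critical_discrete_morse G f"
    and "grows G f Left (Max (f ` simplices G)) t"
  shows "labelled_merge_tree G f = t"
  unfolding labelled_merge_tree_def
proof (rule the_equality)
  show "t' = t" if "grows G f Left (Max (f ` simplices G)) t'" for t'
    using grows_unique[OF assms(1) _ that assms(3)] assms(2)
    by (simp add: critical_discrete_morse_iff_inj_on)
qed (fact assms(3))


section \<open>Splitting a star\<close>

text \<open>Sublevel components of the centre are stars whose leaves need not form an initial
  segment, hence an arbitrary set of leaves.\<close>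

definition star_on :: "nat set \<Rightarrow> nat graph" where
  "star_on I = \<lparr>verts = insert 0 I, edges = (\<lambda>i. {0, i}) ` I\<rparr>"

lemma star_graph_eq_star_on: "star_graph n = star_on {1..n}"
  by (auto simp: star_graph_def star_on_def)

lemma simplices_star_on:
  "simplices (star_on I) = insert {0} ((\<lambda>i. {i}) ` I \<union> (\<lambda>i. {0, i}) ` I)"
  by (auto simp: simplices_def star_on_def)

lemma component_isolated:
  assumes "w \<in> verts G" "{} \<notin> edges G" "\<And>e. e \<in> edges G \<Longrightarrow> w \<notin> e"
  shows "component G w = \<lparr>verts = {w}, edges = {}\<rparr>"
proof -
  have "x = w" if "(w, x) \<in> {(x, y). {x, y} \<in> edges G}\<^sup>*" for x
    using that by (induction rule: rtrancl_induct) (use assms in auto)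
  then have "{v \<in> verts G. (w, v) \<in> {(x, y). {x, y} \<in> edges G}\<^sup>*} = {w}"
    using assms by auto
  moreover have "{e \<in> edges G. e \<subseteq> {w}} = {}"
    using assms by (auto simp: subset_singleton_iff)
  ultimately show ?thesis
    by (simp add: component_def Let_def)
qed

text \<open>A leaf is joined to the centre only by its own edge. A leaf that lies below
  \<open>c\<close> while its edge does not is thus present in the sublevel graph but outside this
  component.\<close>

lemma component_star_centre:
  assumes "f {0} < c" and "\<And>i. i \<in> {1..n} \<Longrightarrow> f {i} \<le> f {0, i}"
  shows "component (sublevel (star_graph n) f c) 0 = star_on {i \<in> {1..n}. f {0, i} < c}"
proof -
  let ?G = "sublevel (star_graph n) f c" and ?I = "{i \<in> {1..n}. f {0, i} < c}"
  let ?R = "{(x, y). {x, y} \<in> edges ?G}"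
  have edges: "edges ?G = (\<lambda>i. {0, i}) ` ?I"
    by (auto simp: sublevel_def star_graph_def)
  have "x \<in> insert 0 ?I" if "(0, x) \<in> ?R\<^sup>*" for x
    using that
  proof (induction rule: rtrancl_induct)
    case (step y z)
    then show ?case
      unfolding edges by (auto simp: doubleton_eq_iff)
  qed simp
  moreover have "(0, x) \<in> ?R\<^sup>*" if "x \<in> insert 0 ?I" for x
    using that unfolding edges by auto
  moreover have "insert 0 ?I \<subseteq> verts ?G"
    using assms by (fastforce simp: sublevel_def star_graph_def)
  ultimately have "{v \<in> verts ?G. (0, v) \<in> ?R\<^sup>*} = insert 0 ?I"
    by blast
  moreover have "{e \<in> edges ?G. e \<subseteq> insert 0 ?I} = (\<lambda>i. {0, i}) ` ?I"
    unfolding edges by blast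
  ultimately show ?thesis
    by (simp add: component_def Let_def star_on_def)
qed

lemma component_star_leaf:
  assumes "m \<in> {1..n}" "f {m} < c" "c \<le> f {0, m}"
  shows "component (sublevel (star_graph n) f c) m = \<lparr>verts = {m}, edges = {}\<rparr>"
proof (rule component_isolated)
  show "m \<in> verts (sublevel (star_graph n) f c)"
    using assms by (simp add: sublevel_def star_graph_def)
  show "{} \<notin> edges (sublevel (star_graph n) f c)"
    by (auto simp: sublevel_def star_graph_def)
  show "m \<notin> e" if e: "e \<in> edges (sublevel (star_graph n) f c)" for e
  proof
    assume "m \<in> e"
    moreover obtain i where "e = {0, i}" "f {0, i} < c"
      using e by (auto simp: sublevel_def star_graph_def)
    ultimately show False
      using assms(1,3) by auto
  qed
qed

lemma critical_star_less:
  assumes "critical_discrete_morse (star_graph n) f" "i \<in> {1..n}"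
  shows "f {0} < f {0, i}" "f {i} < f {0, i}"
proof -
  have e: "{0, i} \<in> edges (star_graph n)"
    using assms by (auto simp: star_graph_def)
  then have "f {0} \<le> f {0, i}" "f {i} \<le> f {0, i}"
    using assms unfolding critical_discrete_morse_def discrete_morse_def by blast+
  moreover have inj: "inj_on f (simplices (star_graph n))"
    using assms(1) by (simp add: critical_discrete_morse_iff_inj_on)
  have "f {0} \<noteq> f {0, i}" "f {i} \<noteq> f {0, i}"
    using inj_onD[OF inj, of "{0}" "{0, i}"] inj_onD[OF inj, of "{i}" "{0, i}"] assms(2)
    by (auto simp: star_graph_eq_star_on simplices_star_on)
  ultimately show "f {0} < f {0, i}" "f {i} < f {0, i}"
    by simp_all
qed

lemma Max_star_on:
  assumes "critical_discrete_morse (star_graph n) f" "I \<subseteq> {1..n}" "m \<in> I"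
    and "\<And>i. i \<in> I \<Longrightarrow> f {0, i} \<le> f {0, m}"
  shows "Max (f ` simplices (star_on I)) = f {0, m}"
proof (rule Max_eqI)
  show "finite (f ` simplices (star_on I))"
    using finite_subset[OF assms(2)] by (auto simp: simplices_star_on)
  show "f {0, m} \<in> f ` simplices (star_on I)"
    using assms(3) by (auto simp: simplices_star_on)
  have "f {0} \<le> f {0, m}"
    using critical_star_less(1)[OF assms(1), of m] assms(2,3) by (auto simp: less_imp_le)
  moreover have "f {i} \<le> f {0, m}" if "i \<in> I" for i
    using critical_star_less(2)[OF assms(1), of i] assms(2) assms(4)[OF that] that
    by (meson less_imp_le order_trans subsetD)
  ultimately show "y \<le> f {0, m}" if "y \<in> f ` simplices (star_on I)" for y
    using that assms(4) by (auto simp: simplices_star_on)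
qed

lemma grows_star_centre:
  "grows (star_graph n) f d (f {0}) (Node Leaf (f {0}) Leaf)"
  by (rule grows.vertex) (auto simp: star_graph_def)

text \<open>One step of the construction, shared by both inclusions of the count. Writing the result
  with \<open>joined e\<close> puts the spine first in either case, so \<open>e\<close> is the side
  of the spine: it differs from \<open>d\<close> exactly when the split-off leaf has the smaller
  minimum.\<close>

lemma grows_star_step:
  fixes f :: "nat set \<Rightarrow> real"
  assumes crit: "critical_discrete_morse (star_graph n) f" and m: "m \<in> {1..n}"
    and I: "I = {i \<in> {1..n}. f {0, i} < f {0, m}}"
    and e: "e = (if f {m} < Min (f ` simplices (star_on I)) then opposite d else d)"
    and t: "grows (star_graph n) f e (Max (f ` simplices (star_on I))) t"
  shows "grows (star_graph n) f d (f {0, m}) (joined e (f {0, m}) t (Node Leaf (f {m}) Leaf))"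
proof -
  let ?G = "star_graph n" and ?c = "f {0, m}"
  let ?\<mu> = "Min (f ` simplices (star_on I))" and ?leaf = "Node Leaf (f {m}) Leaf"
  have less: "f {0} < ?c" "f {m} < ?c"
    using critical_star_less[OF crit m] .
  have centre: "component (sublevel ?G f ?c) 0 = star_on I"
    unfolding I using less critical_star_less[OF crit]
    by (intro component_star_centre) (auto simp: less_imp_le)
  have "component (sublevel ?G f ?c) m = \<lparr>verts = {m}, edges = {}\<rparr>"
    using less m by (intro component_star_leaf) auto
  then have leaf: "comp_min ?G f ?c m = f {m}" "comp_max ?G f ?c m = f {m}"
    by (simp_all add: comp_min_def comp_max_def simplices_def)
  have edge: "{0, m} \<in> edges ?G"
    using m by (auto simp: star_graph_def)
  have grows_leaf: "grows ?G f d' (f {m}) ?leaf" for d'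
    using m by (intro grows.vertex[of m]) (auto simp: star_graph_def)
  show ?thesis
  proof (cases "f {m} < ?\<mu>")
    case True
    \<comment> \<open>Here the leaf inherits \<open>d\<close>, so the edge rule is used with
      \<open>m\<close> as its first endpoint; \<open>joined_opposite\<close> restores the
      spine-first form.\<close>
    have "grows ?G f d ?c (joined d ?c ?leaf t)"
    proof (rule grows.edge)
      show "{m, 0} \<in> edges ?G" "f {m, 0} = ?c"
        using edge by (simp_all add: insert_commute)
      show "comp_min ?G f ?c m < comp_min ?G f ?c 0"
        using True by (simp add: leaf) (simp add: comp_min_def centre)
      show "grows ?G f d (comp_max ?G f ?c m) ?leaf"
        by (simp add: leaf grows_leaf)
      show "grows ?G f (opposite d) (comp_max ?G f ?c 0) t"
        using t True by (simp add: comp_max_def centre e)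
    qed
    then show ?thesis
      using True by (simp add: e joined_opposite)
  next
    case False
    \<comment> \<open>A tie would make \<open>{m}\<close> a simplex of the remaining star, but
      \<open>m\<close> is not in \<open>I\<close>, since \<open>I\<close> is cut out by a strict
      inequality.\<close>
    have "f {m} \<noteq> ?\<mu>"
    proof
      assume eq: "f {m} = ?\<mu>"
      have "?\<mu> \<in> f ` simplices (star_on I)"
        unfolding I by (intro Min_in) (auto simp: simplices_star_on)
      then obtain \<sigma> where \<sigma>: "\<sigma> \<in> simplices (star_on I)" "f {m} = f \<sigma>"
        using eq by auto
      then have "\<sigma> \<in> simplices ?G" "{m} \<in> simplices ?G"
        using m by (auto simp: star_graph_eq_star_on simplices_star_on I)
      then have "{m} = \<sigma>"
        using crit \<sigma>(2) by (auto simp: critical_discrete_morse_iff_inj_on inj_on_def)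
      then show False
        using \<sigma>(1) m by (auto simp: simplices_star_on I)
    qed
    then have gt: "?\<mu> < f {m}"
      using False by simp
    have "grows ?G f d ?c (joined d ?c t ?leaf)"
    proof (rule grows.edge[OF edge refl])
      show "comp_min ?G f ?c 0 < comp_min ?G f ?c m"
        using gt by (simp add: leaf) (simp add: comp_min_def centre)
      show "grows ?G f d (comp_max ?G f ?c 0) t"
        using t False by (simp add: comp_max_def centre e)
      show "grows ?G f (opposite d) (comp_max ?G f ?c m) ?leaf"
        by (simp add: leaf grows_leaf)
    qed
    then show ?thesis
      using False by (simp add: e)
  qed
qed


section \<open>Merge trees of stars are caterpillars\<close>

text \<open>The induction removes the edge of largest value. Closure of \<open>I\<close> under
  smaller edge values makes what remains exactly the component of the centre just below that value,
  and this closure is inherited.\<close>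

lemma grows_star_caterpillar:
  fixes f :: "nat set \<Rightarrow> real"
  assumes crit: "critical_discrete_morse (star_graph n) f"
    and "I \<subseteq> {1..n}" and "\<And>i j. i \<in> I \<Longrightarrow> j \<in> {1..n} \<Longrightarrow> f {0, j} < f {0, i} \<Longrightarrow> j \<in> I"
  shows "\<exists>t. grows (star_graph n) f d (Max (f ` simplices (star_on I))) t \<and>
           map_tree (\<lambda>_. ()) t \<in> caterpillars (card I)"
  using assms(2,3)
proof (induction "card I" arbitrary: I d)
  case 0
  then have "I = {}"
    using finite_subset[OF 0(2)] by simp
  then show ?case
    using grows_star_centre[of n f d] by (auto simp: simplices_star_on)
next
  case (Suc k)
  have fin: "finite I"
    using Suc.prems(1) finite_subset by blast
  have "I \<noteq> {}"
    using Suc.hyps(2) by auto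
  then have "Max ((\<lambda>i. f {0, i}) ` I) \<in> (\<lambda>i. f {0, i}) ` I"
    using fin by simp
  then obtain m where m: "m \<in> I" "f {0, m} = Max ((\<lambda>i. f {0, i}) ` I)"
    by auto
  then have max: "f {0, i} \<le> f {0, m}" if "i \<in> I" for i
    using that fin by simp
  have inj: "i = j" if "i \<in> I" "j \<in> I" "f {0, i} = f {0, j}" for i j
  proof -
    have "{0, i} = {0, j}"
      using crit that Suc.prems(1)
      by (intro inj_onD[of f "simplices (star_graph n)"])
        (auto simp: critical_discrete_morse_iff_inj_on star_graph_eq_star_on simplices_star_on)
    then show ?thesis
      by (auto simp: doubleton_eq_iff)
  qed
  let ?J = "I - {m}"
  have J: "?J = {i \<in> {1..n}. f {0, i} < f {0, m}}"
  proof (intro set_eqI iffI)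
    show "i \<in> {i \<in> {1..n}. f {0, i} < f {0, m}}" if "i \<in> ?J" for i
      using that Suc.prems(1) max[of i] inj[of i m] m(1) by (auto simp: less_le)
    show "i \<in> ?J" if "i \<in> {i \<in> {1..n}. f {0, i} < f {0, m}}" for i
      using that Suc.prems(2)[OF m(1)] by auto
  qed
  define e where "e = (if f {m} < Min (f ` simplices (star_on ?J)) then opposite d else d)"
  have "\<exists>t. grows (star_graph n) f e (Max (f ` simplices (star_on ?J))) t \<and>
      map_tree (\<lambda>_. ()) t \<in> caterpillars (card ?J)"
  proof (rule Suc.hyps(1))
    show "k = card ?J"
      using Suc.hyps(2) m(1) fin by simp
    show "?J \<subseteq> {1..n}"
      using Suc.prems(1) by auto
    show "j \<in> ?J" if "i \<in> ?J" "j \<in> {1..n}" "f {0, j} < f {0, i}" for i j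
      using that unfolding J by auto
  qed
  then obtain t where t: "grows (star_graph n) f e (Max (f ` simplices (star_on ?J))) t"
      "map_tree (\<lambda>_. ()) t \<in> caterpillars k"
    using Suc.hyps(2) m(1) fin by (metis card_Suc_Diff1 nat.inject)
  have "m \<in> {1..n}"
    using m(1) Suc.prems(1) by blast
  from grows_star_step[OF crit this J e_def t(1)]
  have "grows (star_graph n) f d (Max (f ` simplices (star_on I)))
      (joined e (f {0, m}) t (Node Leaf (f {m}) Leaf))"
    using Max_star_on[OF crit Suc.prems(1) m(1) max] by simp
  moreover have "map_tree (\<lambda>_. ()) (joined e (f {0, m}) t (Node Leaf (f {m}) Leaf))
      \<in> caterpillars (card I)"
    unfolding Suc.hyps(2)[symmetric] using t(2) by (auto simp: map_tree_joined)
  ultimately show ?case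
    by blast
qed

lemma merge_tree_star_in_caterpillars:
  assumes "critical_discrete_morse (star_graph n) f"
  shows "merge_tree (star_graph n) f \<in> caterpillars n"
proof -
  obtain t where "grows (star_graph n) f Left (Max (f ` simplices (star_graph n))) t"
      "map_tree (\<lambda>_. ()) t \<in> caterpillars n"
    using grows_star_caterpillar[OF assms, of "{1..n}"] by (auto simp: star_graph_eq_star_on)
  then show ?thesis
    using labelled_merge_tree_eq[OF simple_graph_star_graph assms] by (simp add: merge_tree_def)
qed


section \<open>Every caterpillar is a merge tree\<close>

text \<open>The edges enter in the order of their leaves; \<open>b k\<close> says whether the leaf \<open>k\<close> lies below
  everything that enters before it.\<close>

definition morse :: "(nat \<Rightarrow> bool) \<Rightarrow> nat set \<Rightarrow> real" where
  "morse b \<sigma> = (let k = int (Max \<sigma>) in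
     of_int (if 0 \<in> \<sigma> then 2 * k else if b (Max \<sigma>) then - k else 2 * k - 1))"

lemma morse_simps:
  "morse b {0} = 0"
  "morse b {0, i} = 2 * real i"
  "i > 0 \<Longrightarrow> morse b {i} = (if b i then - real i else 2 * real i - 1)"
  by (simp_all add: morse_def Let_def)

text \<open>The centre has value 0, edges have positive even values, and leaves have values that are
  odd and positive or else negative. All values are integers, so the comparison becomes integer
  arithmetic.\<close>

lemma inj_on_morse: "inj_on (morse b) (simplices (star_graph n))"
proof (rule inj_onI)
  fix \<sigma> \<tau>
  assume \<sigma>: "\<sigma> \<in> simplices (star_graph n)" and \<tau>: "\<tau> \<in> simplices (star_graph n)"
    and "morse b \<sigma> = morse b \<tau>"
  then have eq: "(if 0 \<in> \<sigma> then 2 * int (Max \<sigma>)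
        else if b (Max \<sigma>) then - int (Max \<sigma>) else 2 * int (Max \<sigma>) - 1) =
      (if 0 \<in> \<tau> then 2 * int (Max \<tau>)
        else if b (Max \<tau>) then - int (Max \<tau>) else 2 * int (Max \<tau>) - 1)"
    unfolding morse_def Let_def of_int_eq_iff by -
  \<comment> \<open>A simplex of the star is determined by its maximum and by whether it contains
    the centre.\<close>
  have form: "\<rho> = (if 0 \<in> \<rho> then {0, Max \<rho>} else {Max \<rho>})" and pos: "0 \<in> \<rho> \<or> Max \<rho> > 0"
    if "\<rho> \<in> simplices (star_graph n)" for \<rho>
    using that by (auto simp: star_graph_eq_star_on simplices_star_on)
  have "(0 \<in> \<sigma> \<longleftrightarrow> 0 \<in> \<tau>) \<and> Max \<sigma> = Max \<tau>"
    using eq pos[OF \<sigma>] pos[OF \<tau>] by (simp split: if_splits; presburger)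
  then show "\<sigma> = \<tau>"
    using form[OF \<sigma>] form[OF \<tau>] by metis
qed

lemma critical_morse: "critical_discrete_morse (star_graph n) (morse b)"
proof -
  note inj = inj_on_morse[of b n]
  have "finite {\<sigma> \<in> simplices (star_graph n). morse b \<sigma> = r} \<and>
      card {\<sigma> \<in> simplices (star_graph n). morse b \<sigma> = r} \<le> 2" for r
  proof -
    have fin: "finite (simplices (star_graph n))"
      by (simp add: star_graph_eq_star_on simplices_star_on)
    then have "card {\<sigma> \<in> simplices (star_graph n). morse b \<sigma> = r} \<le> Suc 0"
      using inj by (subst card_le_Suc0_iff_eq) (auto simp: inj_on_def)
    then show ?thesis
      using fin by simp
  qed
  moreover have "morse b {v} \<le> morse b e" if "e \<in> edges (star_graph n)" "v \<in> e" for e v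
    using that by (auto simp: star_graph_def morse_simps)
  ultimately show ?thesis
    using inj unfolding critical_discrete_morse_iff_inj_on discrete_morse_def
    by (auto simp: inj_on_def)
qed

lemma Max_morse: "Max (morse b ` simplices (star_on {1..k})) = 2 * real k"
proof (cases "k = 0")
  case True
  then show ?thesis
    by (simp add: simplices_star_on morse_simps)
next
  case False
  then have "Max (morse b ` simplices (star_on {1..k})) = morse b {0, k}"
    by (intro Max_star_on[OF critical_morse[of k]]) (auto simp: morse_simps)
  then show ?thesis
    by (simp add: morse_simps)
qed

text \<open>A low leaf has value \<open>- (k + 1)\<close>, below the centre and all earlier low
  leaves; a high leaf has value \<open>2 * k + 1\<close>, above the centre.\<close>

lemma morse_less_Min_iff:
  "morse b {Suc k} < Min (morse b ` simplices (star_on {1..k})) \<longleftrightarrow> b (Suc k)"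
  by (subst Min_gr_iff) (auto simp: simplices_star_on morse_simps)

text \<open>Quantifying over every \<open>b'\<close> that agrees with \<open>b\<close> up to
  \<open>k\<close>, and over every larger star, lets the induction fix the next bit and add an edge
  without disturbing the tree already obtained.\<close>

lemma grows_morse:
  assumes "t \<in> caterpillars k"
  shows "\<exists>b. \<forall>b' n. (\<forall>i\<le>k. b' i = b i) \<longrightarrow> k \<le> n \<longrightarrow>
    (\<exists>t'. grows (star_graph n) (morse b') d (2 * real k) t' \<and> map_tree (\<lambda>_. ()) t' = t)"
  using assms
proof (induction k arbitrary: d t)
  case 0
  have "grows (star_graph n) (morse b') d (2 * real 0) (Node Leaf 0 Leaf)" for b' n
    using grows_star_centre[of n "morse b'" d] by (simp add: morse_simps)
  moreover have "map_tree (\<lambda>_. ()) (Node Leaf (0 :: real) Leaf) = t"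
    using 0 by simp
  ultimately show ?case
    by blast
next
  case (Suc k)
  from Suc.prems obtain e s where s: "s \<in> caterpillars k" and t: "t = joined e () s (Node Leaf () Leaf)"
    unfolding caterpillars.simps by blast
  from Suc.IH[OF s, of e] obtain b where b: "\<And>b' n. \<lbrakk>\<forall>i\<le>k. b' i = b i; k \<le> n\<rbrakk> \<Longrightarrow>
      \<exists>s'. grows (star_graph n) (morse b') e (2 * real k) s' \<and> map_tree (\<lambda>_. ()) s' = s"
    by blast
  \<comment> \<open>The new leaf must be low exactly when the spine has to leave the side
    \<open>d\<close>, which gives the bit \<open>e \<noteq> d\<close>.\<close>
  have "\<exists>t'. grows (star_graph n) (morse b') d (2 * real (Suc k)) t' \<and> map_tree (\<lambda>_. ()) t' = t"
    if b': "\<forall>i\<le>Suc k. b' i = (b(Suc k := (e \<noteq> d))) i" and n: "Suc k \<le> n" for b' n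
  proof -
    have "\<forall>i\<le>k. b' i = b i"
      using b' by auto
    then obtain s' where s': "grows (star_graph n) (morse b') e (2 * real k) s'"
        "map_tree (\<lambda>_. ()) s' = s"
      using b n by (meson Suc_leD)
    have "grows (star_graph n) (morse b') d (morse b' {0, Suc k})
        (joined e (morse b' {0, Suc k}) s' (Node Leaf (morse b' {Suc k}) Leaf))"
    proof (rule grows_star_step[OF critical_morse, where I = "{1..k}"])
      show "{1..k} = {i \<in> {1..n}. morse b' {0, i} < morse b' {0, Suc k}}"
        using n by (auto simp: morse_simps)
      show "e = (if morse b' {Suc k} < Min (morse b' ` simplices (star_on {1..k}))
          then opposite d else d)"
        unfolding morse_less_Min_iff using b' by (cases d; cases e) auto
      show "grows (star_graph n) (morse b') e (Max (morse b' ` simplices (star_on {1..k}))) s'"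
        using s'(1) by (simp only: Max_morse)
    qed (use n in auto)
    then show ?thesis
      using s'(2) by (auto simp: morse_simps map_tree_joined t)
  qed
  then show ?case
    by (intro exI[of _ "b(Suc k := (e \<noteq> d))"]) blast
qed

lemma caterpillar_is_merge_tree:
  assumes "t \<in> caterpillars n"
  shows "\<exists>f. critical_discrete_morse (star_graph n) f \<and> merge_tree (star_graph n) f = t"
proof -
  from grows_morse[OF assms, of Left] obtain b t' where
    t': "grows (star_graph n) (morse b) Left (2 * real n) t'" "map_tree (\<lambda>_. ()) t' = t"
    by blast
  have "Max (morse b ` simplices (star_graph n)) = 2 * real n"
    using Max_morse[of b n] by (simp add: star_graph_eq_star_on)
  then have "labelled_merge_tree (star_graph n) (morse b) = t'"
    using t'(1) by (intro labelled_merge_tree_eq[OF simple_graph_star_graph critical_morse]) simp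
  then show ?thesis
    using t'(2) critical_morse by (auto simp: merge_tree_def)
qed

theorem corollary23:
  fixes n :: nat
  assumes "n \<ge> 1"
  shows "card {merge_tree (star_graph n) f | f :: nat set \<Rightarrow> real.
                 critical_discrete_morse (star_graph n) f} = 2 ^ (n - 1)"
proof -
  have "{merge_tree (star_graph n) f | f. critical_discrete_morse (star_graph n) f} = caterpillars n"
    using merge_tree_star_in_caterpillars caterpillar_is_merge_tree by blast
  then show ?thesis
    using assms card_caterpillars[of "n - 1"] by simp
qed

end
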